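(* Let $d \ge 3$. Every $d$-regular graph $G$ has a perfect triangle-free 2-matching.
   Context: Graphs are finite, undirected, without loops and parallel edges; $VG$ and $EG$ denote the node and edge sets of $G$. A graph is $d$-regular if all its nodes have degree $d$. A 2-matching in $G$ is a function $x\colon EG \to \{0,1,2\}$ such that for each node $v \in VG$ the sum of the values $x(e)$ over all edges $e$ incident to $v$ does not exceed $2$. Its size is $\|x\| := \sum_{e \in EG} x(e)$, and $x$ is perfect if $\|x\| = |VG|$. A 2-matching is basic if the set $\{e : x(e) = 1\}$ partitions into a collection of node-disjoint circuits of odd length; by convention only basic 2-matchings are considered. A 2-matching $x$ is triangle-free if its support $\{e \in EG : x(e) \neq 0\}$ contains no triangle (circuit of length 3). *)

theory Defs
  imports Main "HOL-Library.Disjoint_Sets"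
begin

text \<open>A finite simple graph is given by its node set \<open>V\<close> and its edge set \<open>E\<close>;
  an edge is the two-element set of its end nodes.\<close>

definition simple_graph :: "'a set \<Rightarrow> 'a set set \<Rightarrow> bool" where
  "simple_graph V E \<longleftrightarrow> finite V \<and> (\<forall>e\<in>E. e \<subseteq> V \<and> card e = 2)"

definition incident_edges :: "'a set set \<Rightarrow> 'a \<Rightarrow> 'a set set" where
  "incident_edges E v = {e \<in> E. v \<in> e}"

definition regular_graph :: "nat \<Rightarrow> 'a set \<Rightarrow> 'a set set \<Rightarrow> bool" where
  "regular_graph d V E \<longleftrightarrow> simple_graph V E \<and> (\<forall>v\<in>V. card (incident_edges E v) = d)"

text \<open>A circuit is identified with its edge set, so its node set is \<open>\<Union>C\<close>. The nodes in
  \<open>vs\<close> are listed in cyclic order.\<close>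

definition circuit :: "nat \<Rightarrow> 'a set set \<Rightarrow> bool" where
  "circuit n C \<longleftrightarrow> n \<ge> 3 \<and>
     (\<exists>vs. distinct vs \<and> length vs = n \<and> C = {{vs ! i, vs ! (Suc i mod n)} | i. i < n})"

text \<open>A function on edges is given as a total function on sets; only its values on \<open>E\<close>
  are ever used.\<close>

definition two_matching :: "'a set \<Rightarrow> 'a set set \<Rightarrow> ('a set \<Rightarrow> nat) \<Rightarrow> bool" where
  "two_matching V E x \<longleftrightarrow>
     (\<forall>e\<in>E. x e \<in> {0, 1, 2}) \<and> (\<forall>v\<in>V. (\<Sum>e\<in>incident_edges E v. x e) \<le> 2)"

definition matching_size :: "'a set set \<Rightarrow> ('a set \<Rightarrow> nat) \<Rightarrow> nat" where
  "matching_size E x = (\<Sum>e\<in>E. x e)"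

definition perfect_matching :: "'a set \<Rightarrow> 'a set set \<Rightarrow> ('a set \<Rightarrow> nat) \<Rightarrow> bool" where
  "perfect_matching V E x \<longleftrightarrow> matching_size E x = card V"

definition basic_matching :: "'a set set \<Rightarrow> ('a set \<Rightarrow> nat) \<Rightarrow> bool" where
  "basic_matching E x \<longleftrightarrow>
     (\<exists>P. partition_on {e \<in> E. x e = 1} P \<and>
          (\<forall>C\<in>P. \<exists>n. odd n \<and> circuit n C) \<and>
          pairwise (\<lambda>C D. disjnt (\<Union>C) (\<Union>D)) P)"

definition matching_support :: "'a set set \<Rightarrow> ('a set \<Rightarrow> nat) \<Rightarrow> 'a set set" where
  "matching_support E x = {e \<in> E. x e \<noteq> 0}"

definition triangle_free_matching :: "'a set set \<Rightarrow> ('a set \<Rightarrow> nat) \<Rightarrow> bool" where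
  "triangle_free_matching E x \<longleftrightarrow> \<not> (\<exists>C. C \<subseteq> matching_support E x \<and> circuit 3 C)"

lemma circuit_3_iff:
  "circuit 3 C \<longleftrightarrow> (\<exists>a b c. a \<noteq> b \<and> b \<noteq> c \<and> a \<noteq> c \<and> C = {{a, b}, {b, c}, {c, a}})"
proof -
  have cyc: "{{vs ! i, vs ! (Suc i mod 3)} | i. i < 3}
      = {{vs ! 0, vs ! 1}, {vs ! 1, vs ! 2}, {vs ! 2, vs ! 0}}" for vs :: "'a list"
  proof -
    have "{..<3} = {0, 1, 2::nat}" by auto
    moreover have "{{vs ! i, vs ! (Suc i mod 3)} | i. i < 3}
        = (\<lambda>i. {vs ! i, vs ! (Suc i mod 3)}) ` {..<3}" by blast
    ultimately show ?thesis by (simp add: numeral_2_eq_2)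
  qed
  show ?thesis
  proof
    assume "circuit 3 C"
    then obtain vs where vs: "distinct vs" "length vs = 3"
      and C: "C = {{vs ! i, vs ! (Suc i mod 3)} | i. i < 3}"
      by (auto simp: circuit_def)
    have "vs ! 0 \<noteq> vs ! 1" "vs ! 1 \<noteq> vs ! 2" "vs ! 0 \<noteq> vs ! 2"
      using vs by (simp_all add: nth_eq_iff_index_eq)
    then show "\<exists>a b c. a \<noteq> b \<and> b \<noteq> c \<and> a \<noteq> c \<and> C = {{a, b}, {b, c}, {c, a}}"
      unfolding C cyc by blast
  next
    assume "\<exists>a b c. a \<noteq> b \<and> b \<noteq> c \<and> a \<noteq> c \<and> C = {{a, b}, {b, c}, {c, a}}"
    then obtain a b c where "a \<noteq> b" "b \<noteq> c" "a \<noteq> c" and C: "C = {{a, b}, {b, c}, {c, a}}"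
      by blast
    then have "distinct [a, b, c]" "length [a, b, c] = 3" by auto
    moreover have "C = {{[a, b, c] ! i, [a, b, c] ! (Suc i mod 3)} | i. i < 3}"
      unfolding C cyc by simp
    ultimately show "circuit 3 C" unfolding circuit_def by blast
  qed
qed

end

theory Submission
  imports Defs Complex_Main
begin

text \<open>Consider the polytope of all nonnegative edge weightings with weighted degree 2 at every node and
  weight at most 2 on every triangle; it contains the constant weighting \<open>2 / d\<close>. At an extreme
  point \<open>x\<close>, let \<open>F\<close> be the set of edges with \<open>0 < x e < 2\<close> and \<open>W\<close> the set of nodes covered by \<open>F\<close>.
  The tight triangles with all edges in \<open>F\<close> are edge-disjoint, so a node of \<open>W\<close> lying on \<open>k\<close> of them has
  at least \<open>2 + k\<close> edges in \<open>F\<close>. If there are \<open>t\<close> such triangles, then \<open>2 |F| \<ge> 2 |W| + 3 t\<close>, whereas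
  extremality forces \<open>|F| \<le> |W| + t\<close>. Hence \<open>t = 0\<close> and \<open>F\<close> is a disjoint union of circuits.
  The vectors \<open>x - 1\<close> on \<open>F\<close> and \<open>\<plusminus>1\<close> alternating along an even circuit are feasible directions,
  so \<open>x = 1\<close> on \<open>F\<close> and all circuits are odd.\<close>

section \<open>Linear systems and step lengths\<close>

lemma homogeneous_system_nontrivial:
  fixes A :: "('e \<Rightarrow> real) set"
  assumes "finite A" "finite F" "card A < card F"
  shows "\<exists>y. (\<exists>e\<in>F. y e \<noteq> 0) \<and> (\<forall>e. e \<notin> F \<longrightarrow> y e = 0) \<and> (\<forall>a\<in>A. (\<Sum>e\<in>F. a e * y e) = 0)"
  using assms
proof (induction "card A" arbitrary: A F rule: less_induct)
  case less
  show ?case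
  proof (cases "A = {}")
    case True
    with less.prems obtain f where "f \<in> F" by (metis card.empty card_gt_0_iff ex_in_conv)
    then show ?thesis using True by (intro exI[of _ "\<lambda>e. of_bool (e = f)"]) auto
  next
    case False
    then obtain c where c: "c \<in> A" by blast
    define B where "B = A - {c}"
    have B: "finite B" "card B < card A" "A = insert c B"
      using c less.prems card_Diff1_less[of A c] unfolding B_def by auto
    show ?thesis
    proof (cases "\<forall>f\<in>F. c f = 0")
      case True
      have "card B < card F" using B less.prems by simp
      then obtain y where "\<exists>e\<in>F. y e \<noteq> 0" "\<forall>e. e \<notin> F \<longrightarrow> y e = 0"
          "\<forall>a\<in>B. (\<Sum>e\<in>F. a e * y e) = 0"
        using less.hyps[of B F] B less.prems by blast
      then show ?thesis using True B(3) by (intro exI[of _ y]) auto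
    next
      case False
      then obtain f where f: "f \<in> F" "c f \<noteq> 0" by blast
      define F' where "F' = F - {f}"
      \<comment> \<open>These are the rows of \<open>B\<close> with \<open>f\<close> eliminated by
        means of the pivot row \<open>c\<close>. Distinct rows may become equal, which only lowers
        their number.\<close>
      define B' where "B' = (\<lambda>b e. b e - b f / c f * c e) ` B"
      have F': "finite F'" "F = insert f F'" "f \<notin> F'" using f less.prems unfolding F'_def by auto
      have "card B' \<le> card B" unfolding B'_def by (rule card_image_le[OF B(1)])
      moreover have "card A = Suc (card B)" using c less.prems(1) unfolding B_def by (metis card.remove)
      moreover have "card F = Suc (card F')" unfolding F'(2) using F'(1,3) by simp
      ultimately have "card B' < card A" "card B' < card F'" using less.prems by auto
      moreover have "finite B'" using B B'_def by simp
      ultimately obtain z where z: "\<exists>e\<in>F'. z e \<noteq> 0" "\<forall>e. e \<notin> F' \<longrightarrow> z e = 0"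
          "\<forall>a\<in>B'. (\<Sum>e\<in>F'. a e * z e) = 0"
        using less.hyps[of B' F'] F'(1) by blast
      define s where "s = (\<Sum>e\<in>F'. c e * z e)"
      \<comment> \<open>Back substitution: the value at \<open>f\<close> is the one that solves the
        pivot equation.\<close>
      define y where "y = z(f := - s / c f)"
      have y_sum: "(\<Sum>e\<in>F. b e * y e) = (\<Sum>e\<in>F'. b e * z e) - b f * s / c f" for b
      proof -
        have "(\<Sum>e\<in>F'. b e * y e) = (\<Sum>e\<in>F'. b e * z e)"
          using F'(3) by (intro sum.cong) (auto simp: y_def)
        then show ?thesis unfolding F'(2) using F'(1,3) by (simp add: y_def)
      qed
      have "(\<Sum>e\<in>F. b e * y e) = 0" if "b \<in> B" for b
      proof -
        have "0 = (\<Sum>e\<in>F'. (b e - b f / c f * c e) * z e)" using z(3) that unfolding B'_def by auto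
        also have "\<dots> = (\<Sum>e\<in>F'. b e * z e) - b f / c f * s"
          by (simp add: s_def left_diff_distrib sum_subtractf sum_distrib_left mult.assoc)
        finally show ?thesis by (simp add: y_sum)
      qed
      moreover have "(\<Sum>e\<in>F. c e * y e) = 0" using f by (simp add: y_sum s_def)
      moreover have "\<exists>e\<in>F. y e \<noteq> 0" "\<forall>e. e \<notin> F \<longrightarrow> y e = 0"
        using z F' by (auto simp: y_def)
      ultimately show ?thesis using B(3) by (intro exI[of _ y]) auto
    qed
  qed
qed

text \<open>The ratio test of the simplex method: \<open>t\<close> is the smallest ratio
  \<open>p i / - q i\<close> over the decreasing coordinates, where the first of them reaches zero.
  The condition on zeros of \<open>p\<close> ensures that this coordinate was positive
  before.\<close>

lemma ratio_test:
  fixes p q :: "'i \<Rightarrow> real"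
  assumes "finite I" and p: "\<And>i. i \<in> I \<Longrightarrow> 0 \<le> p i" and q: "\<And>i. i \<in> I \<Longrightarrow> p i = 0 \<Longrightarrow> q i = 0"
    and "\<exists>i\<in>I. q i < 0"
  shows "\<exists>t. (\<forall>i\<in>I. 0 \<le> p i + t * q i) \<and> (\<exists>i\<in>I. p i \<noteq> 0 \<and> p i + t * q i = 0)"
proof -
  define J where "J = {i \<in> I. q i < 0}"
  define t where "t = Min ((\<lambda>i. p i / - q i) ` J)"
  have J: "finite J" "J \<noteq> {}" using assms by (auto simp: J_def)
  then have "t \<in> (\<lambda>i. p i / - q i) ` J" unfolding t_def by (intro Min_in) auto
  then obtain j where j: "j \<in> J" "t = p j / - q j" by blast
  have "0 \<le> p j" "q j < 0" using j p by (auto simp: J_def)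
  then have "0 \<le> t" using j by (simp add: divide_nonneg_pos del: divide_minus_right)
  have "0 \<le> p i + t * q i" if i: "i \<in> I" for i
  proof (cases "q i < 0")
    case True
    then have "t \<le> p i / - q i" using i J unfolding t_def by (intro Min_le) (auto simp: J_def)
    then have "t * - q i \<le> p i" using True by (subst (asm) pos_le_divide_eq) auto
    then show ?thesis by simp
  next
    case False
    then show ?thesis using p[OF i] \<open>0 \<le> t\<close> by simp
  qed
  moreover have "p j \<noteq> 0" using j q by (auto simp: J_def)
  moreover have "p j + t * q j = 0" using j by (auto simp: J_def)
  ultimately show ?thesis using j unfolding J_def by blast
qed

section \<open>The polytope and its extreme points\<close>

text \<open>A triangle is represented by its node set \<open>T\<close>. In a simple graph, if
  \<open>T\<close> does not span a triangle, the bound agrees with the degree equations, since two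
  edges inside \<open>T\<close> share a node.\<close>

definition triangle_polytope :: "'a set \<Rightarrow> 'a set set \<Rightarrow> ('a set \<Rightarrow> real) set" where
  "triangle_polytope V E = {x. (\<forall>e\<in>E. 0 \<le> x e) \<and> (\<forall>v\<in>V. sum x (incident_edges E v) = 2) \<and>
     (\<forall>T. T \<subseteq> V \<and> card T = 3 \<longrightarrow> sum x (E \<inter> Pow T) \<le> 2)}"

text \<open>Extremality in algebraic form: only the zero vector on \<open>E\<close> satisfies the
  homogeneous versions of all constraints that are tight at \<open>x\<close>. Each later use of
  \<open>extreme\<close> thus consists of exhibiting a suitable perturbation
  \<open>y\<close>.\<close>

locale extreme_point =
  fixes V :: "'a set" and E :: "'a set set" and x :: "'a set \<Rightarrow> real"
  assumes graph: "simple_graph V E"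
    and polytope: "x \<in> triangle_polytope V E"
    and extreme: "\<And>(y :: 'a set \<Rightarrow> real) e. \<lbrakk>\<And>e. e \<in> E \<Longrightarrow> x e = 0 \<Longrightarrow> y e = 0;
          \<And>v. v \<in> V \<Longrightarrow> sum y (incident_edges E v) = 0;
          \<And>T. T \<subseteq> V \<Longrightarrow> card T = 3 \<Longrightarrow> sum x (E \<inter> Pow T) = 2 \<Longrightarrow> sum y (E \<inter> Pow T) = 0;
          e \<in> E\<rbrakk> \<Longrightarrow> y e = 0"

lemma simple_graph_finite_edges: "simple_graph V E \<Longrightarrow> finite E"
  unfolding simple_graph_def by (metis PowI finite_Pow_iff finite_subset subsetI)

text \<open>A point with the greatest number of tight inequalities is extreme: along a nonzero
  direction that keeps the tight ones tight, one could move until a further inequality becomes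
  tight.\<close>

lemma extreme_point_exists:
  assumes graph: "simple_graph V E" and x0: "x0 \<in> triangle_polytope V E"
  shows "\<exists>x. extreme_point V E x"
proof -
  \<comment> \<open>One index set serves both kinds of inequalities: edges have two elements and
    triangles three, so the cardinality of \<open>S\<close> tells which slack is meant.\<close>
  define I where "I = E \<union> {T. T \<subseteq> V \<and> card T = 3}"
  define slack where "slack x S = (if card S = 2 then x S else 2 - sum x (E \<inter> Pow S))"
    for x :: "'a set \<Rightarrow> real" and S
  define Z where "Z x = {S \<in> I. slack x S = 0}" for x
  have E2: "card e = 2" if "e \<in> E" for e using graph that by (auto simp: simple_graph_def)
  have finE: "finite E" using graph by (rule simple_graph_finite_edges)
  have finI: "finite I" using graph finE by (simp add: I_def simple_graph_def)
  have poly: "x \<in> triangle_polytope V E \<longleftrightarrow>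
      (\<forall>v\<in>V. sum x (incident_edges E v) = 2) \<and> (\<forall>S\<in>I. 0 \<le> slack x S)" for x
  proof -
    have "(\<forall>S\<in>I. 0 \<le> slack x S) \<longleftrightarrow>
        (\<forall>S\<in>E. 0 \<le> slack x S) \<and> (\<forall>S. S \<subseteq> V \<and> card S = 3 \<longrightarrow> 0 \<le> slack x S)"
      unfolding I_def by blast
    also have "\<dots> \<longleftrightarrow> (\<forall>e\<in>E. 0 \<le> x e) \<and> (\<forall>T. T \<subseteq> V \<and> card T = 3 \<longrightarrow> sum x (E \<inter> Pow T) \<le> 2)"
      using E2 by (simp add: slack_def)
    finally show ?thesis unfolding triangle_polytope_def by blast
  qed
  obtain x where x: "x \<in> triangle_polytope V E"
    and max: "\<And>x'. x' \<in> triangle_polytope V E \<Longrightarrow> card (Z x') \<le> card (Z x)"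
  proof -
    have "card (Z x) < Suc (card I)" for x
      using card_mono[OF finI, of "Z x"] by (auto simp: Z_def)
    then show thesis
      using that ex_has_greatest_nat[of "\<lambda>x. x \<in> triangle_polytope V E" x0 "\<lambda>x. card (Z x)" "Suc (card I)"]
        x0 by (metis (no_types, lifting) less_imp_le)
  qed
  have "extreme_point V E x"
  proof
    fix y :: "'a set \<Rightarrow> real" and e
    assume supp: "\<And>e. e \<in> E \<Longrightarrow> x e = 0 \<Longrightarrow> y e = 0"
      and deg: "\<And>v. v \<in> V \<Longrightarrow> sum y (incident_edges E v) = 0"
      and tri: "\<And>T. T \<subseteq> V \<Longrightarrow> card T = 3 \<Longrightarrow> sum x (E \<inter> Pow T) = 2 \<Longrightarrow> sum y (E \<inter> Pow T) = 0"
      and e: "e \<in> E"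
    show "y e = 0"
    proof (rule ccontr)
      assume ne: "y e \<noteq> 0"
      \<comment> \<open>The values of \<open>y\<close> at an end of \<open>e\<close> sum to 0 and
        are not all 0, so one of them is negative; its edge will block the motion along
        \<open>y\<close>.\<close>
      have "\<exists>f\<in>E. y f < 0"
      proof (rule ccontr)
        assume "\<not> (\<exists>f\<in>E. y f < 0)"
        then have nn: "0 \<le> y f" if "f \<in> E" for f using that by force
        have "e \<noteq> {}" using E2[OF e] by auto
        then obtain v where v: "v \<in> e" by blast
        then have "v \<in> V" using graph e by (auto simp: simple_graph_def)
        have "sum y (incident_edges E v) = 0" using \<open>v \<in> V\<close> by (rule deg)
        then have "y e = 0" using finE e v nn
          by (subst (asm) sum_nonneg_eq_0_iff) (auto simp: incident_edges_def)
        then show False using ne by simp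
      qed
      define q where "q S = (if card S = 2 then y S else - sum y (E \<inter> Pow S))" for S
      have "\<exists>t. (\<forall>S\<in>I. 0 \<le> slack x S + t * q S) \<and> (\<exists>S\<in>I. slack x S \<noteq> 0 \<and> slack x S + t * q S = 0)"
      proof (rule ratio_test[OF finI])
        show "0 \<le> slack x S" if "S \<in> I" for S using x that poly by blast
        show "q S = 0" if "S \<in> I" "slack x S = 0" for S
          using that supp tri E2 by (auto simp: I_def slack_def q_def split: if_splits)
        show "\<exists>i\<in>I. q i < 0" using \<open>\<exists>f\<in>E. y f < 0\<close> E2 by (auto simp: I_def q_def)
      qed
      then obtain t S where t: "\<forall>S\<in>I. 0 \<le> slack x S + t * q S"
        and S: "S \<in> I" "slack x S \<noteq> 0" "slack x S + t * q S = 0" by blast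
      define x' where "x' = (\<lambda>e. x e + t * y e)"
      have slack': "slack x' S = slack x S + t * q S" for S
        by (simp add: slack_def x'_def q_def sum.distrib sum_distrib_left)
      have "x' \<in> triangle_polytope V E" unfolding poly
        using x t deg by (simp add: slack' poly) (simp add: x'_def sum.distrib flip: sum_distrib_left)
      moreover have "Z x \<subset> Z x'"
      proof -
        have "q R = 0" if "R \<in> I" "slack x R = 0" for R
          using that supp tri E2 by (auto simp: I_def slack_def q_def split: if_splits)
        then show ?thesis using S by (auto simp: Z_def slack')
      qed
      then have "card (Z x) < card (Z x')" using finI by (intro psubset_card_mono) (auto simp: Z_def)
      ultimately show False using max by fastforce
    qed
  qed (use graph x in auto)
  then show ?thesis by blast
qed

text \<open>Three nodes span at most three edges, of total weight at most \<open>6 / d\<close>; this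
  is where \<open>d \<ge> 3\<close> enters.\<close>

lemma uniform_in_triangle_polytope:
  assumes "d \<ge> 3" and "regular_graph d V E"
  shows "(\<lambda>e. 2 / real d) \<in> triangle_polytope V E"
proof -
  have graph: "simple_graph V E" and deg: "\<And>v. v \<in> V \<Longrightarrow> card (incident_edges E v) = d"
    using assms by (auto simp: regular_graph_def)
  have "real (card (E \<inter> Pow T)) * (2 / real d) \<le> 2" if "T \<subseteq> V" "card T = 3" for T
  proof -
    have "E \<inter> Pow T \<subseteq> {e. e \<subseteq> T \<and> card e = 2}" using graph by (auto simp: simple_graph_def)
    moreover have "finite T" using that card.infinite by fastforce
    ultimately have "card (E \<inter> Pow T) \<le> card {e. e \<subseteq> T \<and> card e = 2}"
      by (intro card_mono) auto
    also have "\<dots> = card T choose 2" using \<open>finite T\<close> by (rule n_subsets)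
    finally have "card (E \<inter> Pow T) \<le> card T choose 2" .
    then have "card (E \<inter> Pow T) \<le> 3" using that by (simp add: choose_two)
    then have "real (card (E \<inter> Pow T)) * (2 / real d) \<le> 3 * (2 / 3)"
      using assms by (intro mult_mono frac_le) auto
    then show ?thesis by simp
  qed
  then show ?thesis using assms deg by (auto simp: triangle_polytope_def)
qed

section \<open>Fractional edges and tight triangles at an extreme point\<close>

context extreme_point
begin

lemma finite_nodes: "finite V" and finite_edges: "finite E"
  using graph simple_graph_finite_edges by (auto simp: simple_graph_def)

lemma card_edge: "e \<in> E \<Longrightarrow> card e = 2" and edge_subset: "e \<in> E \<Longrightarrow> e \<subseteq> V"
  using graph by (auto simp: simple_graph_def)

lemma nonneg: "e \<in> E \<Longrightarrow> 0 \<le> x e"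
  and degree: "v \<in> V \<Longrightarrow> sum x (incident_edges E v) = 2"
  and triangle_le: "T \<subseteq> V \<Longrightarrow> card T = 3 \<Longrightarrow> sum x (E \<inter> Pow T) \<le> 2"
  using polytope by (auto simp: triangle_polytope_def)

definition F where "F = {e \<in> E. 0 < x e \<and> x e < 2}"

definition W where "W = \<Union>F"

text \<open>Requiring three edges in \<open>F\<close> selects the tight constraints that still have
  to be imposed on a perturbation supported on \<open>F\<close> with zero degree sums; see
  \<open>inner_extreme\<close>.\<close>

definition tight_triangles where
  "tight_triangles = {T. T \<subseteq> V \<and> card T = 3 \<and> card (F \<inter> Pow T) = 3 \<and> sum x (E \<inter> Pow T) = 2}"

lemma F_subset: "F \<subseteq> E" and finite_F: "finite F"
  using finite_edges by (auto simp: F_def)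

lemma card_F_edge: "e \<in> F \<Longrightarrow> card e = 2"
  using F_subset card_edge by blast

lemma F_pos: "e \<in> F \<Longrightarrow> 0 < x e" and F_less: "e \<in> F \<Longrightarrow> x e < 2"
  by (auto simp: F_def)

lemma W_subset: "W \<subseteq> V"
  using F_subset edge_subset by (auto simp: W_def)

lemma finite_W: "finite W"
  using W_subset finite_nodes by (rule finite_subset)

lemma finite_tight_triangles: "finite tight_triangles"
  using finite_nodes by (simp add: tight_triangles_def)

lemma pair_le:
  assumes "v \<in> V" "e \<in> incident_edges E v" "f \<in> incident_edges E v" "e \<noteq> f"
  shows "x e + x f \<le> 2"
proof -
  have "sum x {e, f} \<le> sum x (incident_edges E v)"
    using assms finite_edges nonneg by (intro sum_mono2) (auto simp: incident_edges_def)
  then show ?thesis using assms degree by simp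
qed

lemma le_2:
  assumes "e \<in> E"
  shows "x e \<le> 2"
proof -
  obtain v where v: "v \<in> e" using card_edge[OF assms] by fastforce
  have "x e \<le> sum x (incident_edges E v)"
    using assms v finite_edges nonneg by (intro member_le_sum) (auto simp: incident_edges_def)
  then show ?thesis using assms v degree edge_subset by fastforce
qed

text \<open>An edge of weight 2 exhausts the degree of its ends, so it cannot share a node with an
  edge of \<open>F\<close>, whose weight is positive.\<close>

lemma support_at_W:
  assumes "v \<in> W" "e \<in> incident_edges E v" "x e \<noteq> 0"
  shows "e \<in> F"
proof -
  obtain f where f: "f \<in> F" "v \<in> f" using assms by (auto simp: W_def)
  have "x e < 2"
  proof (cases "e = f")
    case False
    then have "x e + x f \<le> 2"
      using assms f W_subset F_subset by (intro pair_le[of v]) (auto simp: incident_edges_def)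
    then show ?thesis using F_pos f by fastforce
  qed (use f F_less in auto)
  then show ?thesis using assms nonneg by (force simp: F_def incident_edges_def)
qed

text \<open>By \<open>support_at_W\<close>, the edges outside \<open>F\<close> at a node of
  \<open>W\<close> have weight 0 and hence contribute nothing to \<open>y\<close>.\<close>

lemma sum_incident_F:
  assumes "v \<in> W" "\<And>e. e \<in> E \<Longrightarrow> x e = 0 \<Longrightarrow> y e = 0"
  shows "sum y (incident_edges E v) = sum y (incident_edges F v)"
proof (rule sum.mono_neutral_right)
  show "finite (incident_edges E v)" using finite_edges by (simp add: incident_edges_def)
  show "incident_edges F v \<subseteq> incident_edges E v" using F_subset by (auto simp: incident_edges_def)
  show "\<forall>e \<in> incident_edges E v - incident_edges F v. y e = 0"
  proof
    fix e assume e: "e \<in> incident_edges E v - incident_edges F v"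
    then have "x e = 0" using support_at_W[OF assms(1), of e] by (auto simp: incident_edges_def)
    then show "y e = 0" using assms(2) e by (simp add: incident_edges_def)
  qed
qed

lemma degree_F:
  assumes "v \<in> W"
  shows "sum x (incident_edges F v) = 2"
  using sum_incident_F[OF assms, of x] degree[of v] assms W_subset by auto

lemma triangle_edges:
  assumes "G \<subseteq> E" "distinct [a, b, c]"
  shows "G \<inter> Pow {a, b, c} \<subseteq> {{a, b}, {a, c}, {b, c}}"
proof
  fix e assume e: "e \<in> G \<inter> Pow {a, b, c}"
  then have "card e = 2" using assms card_edge by auto
  then obtain p q where "e = {p, q}" "p \<noteq> q" by (auto simp: card_2_iff)
  then show "e \<in> {{a, b}, {a, c}, {b, c}}" using e by (auto simp: insert_commute)
qed

lemma card_3_third: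
  assumes "card T = 3" "a \<in> T" "b \<in> T" "a \<noteq> b"
  obtains c where "T = {a, b, c}" "c \<noteq> a" "c \<noteq> b"
proof -
  have "finite T" using assms card.infinite by fastforce
  then have "card (T - {a, b}) = 1" using assms by simp
  then obtain c where "T - {a, b} = {c}" by (auto simp: card_1_singleton_iff)
  then show thesis using assms by (intro that[of c]) auto
qed

text \<open>Three nodes have only three pairs, so three edges of \<open>F\<close> inside
  \<open>T\<close> must be all of them. Two nodes may be prescribed, which lets later arguments fix
  a common node or edge.\<close>

lemma tight_triangleE:
  assumes "T \<in> tight_triangles" "a \<in> T" "b \<in> T" "a \<noteq> b"
  obtains c where "T = {a, b, c}" "c \<noteq> a" "c \<noteq> b" "{a, b} \<in> F" "{a, c} \<in> F" "{b, c} \<in> F"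
    "F \<inter> Pow T = {{a, b}, {a, c}, {b, c}}" "x {a, b} + x {a, c} + x {b, c} = 2"
proof -
  have "card T = 3" using assms by (simp add: tight_triangles_def)
  then obtain c where c: "T = {a, b, c}" "c \<noteq> a" "c \<noteq> b"
    by (rule card_3_third[OF _ assms(2-4)])
  have d: "distinct [a, b, c]" using c assms by auto
  have card3: "card {{a, b}, {a, c}, {b, c}} = 3"
    using d by (simp add: doubleton_eq_iff)
  have F: "F \<inter> Pow T = {{a, b}, {a, c}, {b, c}}"
    using assms triangle_edges[OF F_subset d] card3 c
    by (intro card_subset_eq) (auto simp: tight_triangles_def)
  have "E \<inter> Pow T = {{a, b}, {a, c}, {b, c}}"
    using triangle_edges[OF subset_refl d] F F_subset c by auto
  then have "sum x {{a, b}, {a, c}, {b, c}} = 2" using assms by (auto simp: tight_triangles_def)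
  then have "x {a, b} + x {a, c} + x {b, c} = 2"
    using d by (simp add: doubleton_eq_iff)
  then show thesis using that c F by blast
qed

lemma other_node:
  assumes "T \<in> tight_triangles" "a \<in> T"
  obtains b where "b \<in> T" "a \<noteq> b"
proof -
  have "card T = 3" using assms by (simp add: tight_triangles_def)
  then have "T \<noteq> {a}" by auto
  then show thesis using assms that by blast
qed

text \<open>A tight triangle with at most two edges in \<open>F\<close> imposes no condition of its own: these two edges
  then carry the whole degree of their common node.\<close>

lemma inner_extreme:
  fixes y :: "'a set \<Rightarrow> real"
  assumes supp: "\<And>e. e \<notin> F \<Longrightarrow> y e = 0"
    and deg: "\<And>v. v \<in> W \<Longrightarrow> sum y (incident_edges F v) = 0"
    and tri: "\<And>T. T \<in> tight_triangles \<Longrightarrow> sum y (F \<inter> Pow T) = 0"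
  shows "y e = 0"
proof (cases "e \<in> F")
  case True
  show ?thesis
  proof (rule extreme[of y])
    show supp0: "y e = 0" if "e \<in> E" "x e = 0" for e
      using that supp by (auto simp: F_def)
    show "sum y (incident_edges E v) = 0" if "v \<in> V" for v
    proof (cases "v \<in> W")
      case True
      then show ?thesis using sum_incident_F[of v y] supp0 deg by simp
    next
      case False
      then show ?thesis using supp by (intro sum.neutral) (auto simp: W_def incident_edges_def)
    qed
    show "sum y (E \<inter> Pow T) = 0" if T: "T \<subseteq> V" "card T = 3" "sum x (E \<inter> Pow T) = 2" for T
    proof -
      have eq: "sum y (E \<inter> Pow T) = sum y (F \<inter> Pow T)"
        using finite_edges F_subset supp by (intro sum.mono_neutral_right) auto
      show ?thesis
      proof (cases "T \<in> tight_triangles \<or> F \<inter> Pow T = {}")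
        case True
        then show ?thesis using eq tri by auto
      next
        case False
        then obtain e where e: "e \<in> F" "e \<subseteq> T" by auto
        have "card e = 2" using e card_F_edge by blast
        then obtain a b where ab: "e = {a, b}" "a \<noteq> b" by (auto simp: card_2_iff)
        then obtain c where c: "T = {a, b, c}" "c \<noteq> a" "c \<noteq> b"
          using card_3_third[OF T(2), of a b] e by auto
        have d: "distinct [a, b, c]" using c ab by auto
        have W: "a \<in> W" "b \<in> W" using e ab by (auto simp: W_def)
        \<comment> \<open>Every pair of nodes of \<open>T\<close> contains \<open>a\<close> or
          \<open>b\<close>, and both lie in \<open>W\<close>.\<close>
        have inF: "f \<in> F" if "f \<in> E \<inter> Pow T" "x f \<noteq> 0" for f
          using that triangle_edges[OF subset_refl d] c support_at_W[OF W(1), of f] 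
            support_at_W[OF W(2), of f] by (auto simp: incident_edges_def)
        have "sum x (E \<inter> Pow T) = sum x (F \<inter> Pow T)"
          using finite_edges F_subset inF by (intro sum.mono_neutral_right) auto
        then have sum2: "sum x (F \<inter> Pow T) = 2" using T by simp
        have sub: "F \<inter> Pow T \<subseteq> {{a, b}, {a, c}, {b, c}}"
          using triangle_edges[OF F_subset d] c by simp
        have "\<not> {{a, b}, {a, c}, {b, c}} \<subseteq> F \<inter> Pow T"
        proof
          assume "{{a, b}, {a, c}, {b, c}} \<subseteq> F \<inter> Pow T"
          then have "F \<inter> Pow T = {{a, b}, {a, c}, {b, c}}" using sub by blast
          then have "card (F \<inter> Pow T) = 3" using d by (simp add: doubleton_eq_iff)
          then show False using False T by (simp add: tight_triangles_def)
        qed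
        \<comment> \<open>Besides \<open>{a, b}\<close>, at most one of the other two pairs is in
          \<open>F\<close>, so all \<open>F\<close>-edges inside \<open>T\<close> share an end of
          \<open>e\<close>.\<close>
        then obtain v where v: "v \<in> {a, b}" "\<forall>f \<in> F \<inter> Pow T. v \<in> f"
          using sub e ab by blast
        have vW: "v \<in> W" using v W by blast
        have sub_v: "F \<inter> Pow T \<subseteq> incident_edges F v" using v by (auto simp: incident_edges_def)
        have fin: "finite (incident_edges F v)" using finite_F by (simp add: incident_edges_def)
        \<comment> \<open>The edges inside \<open>T\<close> already carry the full degree 2 of
          \<open>v\<close>. As edges of \<open>F\<close> have positive weight, there are no others
          at \<open>v\<close>, and the triangle condition becomes the degree condition at
          \<open>v\<close>.\<close>
        have "sum x (incident_edges F v - F \<inter> Pow T) = 0"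
          using sum_diff[OF fin sub_v, of x] degree_F[OF vW] sum2 by simp
        moreover have "0 < sum x (incident_edges F v - F \<inter> Pow T)"
          if "incident_edges F v - F \<inter> Pow T \<noteq> {}"
          using that fin F_pos by (intro sum_pos) (auto simp: incident_edges_def)
        ultimately have "F \<inter> Pow T = incident_edges F v" using sub_v by fastforce
        then show ?thesis using eq deg[OF vW] by simp
      qed
    qed
    show "e \<in> E" using True F_subset by blast
  qed
qed (use supp in auto)

section \<open>Edge-disjointness of tight triangles\<close>

text \<open>Two tight triangles sharing the edge \<open>{a, b}\<close> would leave no further
  \<open>F\<close>-edges at \<open>a\<close> and \<open>b\<close>. This rigidity makes room for a
  nonzero perturbation on a circuit of length 4, against extremality.\<close>

lemma tight_triangles_edge_disjoint:
  assumes T: "T \<in> tight_triangles" and T': "T' \<in> tight_triangles"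
    and e: "e \<in> F" "e \<subseteq> T" "e \<subseteq> T'"
  shows "T = T'"
proof (rule ccontr)
  assume "T \<noteq> T'"
  have "card e = 2" using e card_F_edge by blast
  then obtain a b where ab: "e = {a, b}" "a \<noteq> b" by (auto simp: card_2_iff)
  obtain c where c: "T = {a, b, c}" "c \<noteq> a" "c \<noteq> b" "{a, c} \<in> F" "{b, c} \<in> F"
      "x {a, b} + x {a, c} + x {b, c} = 2"
    using tight_triangleE[OF T, of a b] e ab by auto
  obtain d where d: "T' = {a, b, d}" "d \<noteq> a" "d \<noteq> b" "{a, d} \<in> F" "{b, d} \<in> F"
      "x {a, b} + x {a, d} + x {b, d} = 2"
    using tight_triangleE[OF T', of a b] e ab by auto
  have "c \<noteq> d" using c d \<open>T \<noteq> T'\<close> by auto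
  note dist = ab(2) c(2,3) d(2,3) \<open>c \<noteq> d\<close>
  define A B where "A = {{a, b}, {a, c}, {a, d}}" and "B = {{a, b}, {b, c}, {b, d}}"
  have finite_rest: "finite (incident_edges F u - S)" for u S
    using finite_F by (simp add: incident_edges_def)
  have pos: "0 < x f" if "f \<in> incident_edges F u - S" for f u S
    using F_pos that by (auto simp: incident_edges_def)
  have split: "sum x S + sum x (incident_edges F u - S) = 2" if "u \<in> W" "S \<subseteq> incident_edges F u" for u S
    using degree_F[OF that(1)] sum.subset_diff[OF that(2), of x] finite_F by (simp add: incident_edges_def)
  have "A \<subseteq> incident_edges F a" "B \<subseteq> incident_edges F b" "a \<in> W" "b \<in> W"
    using e ab c d by (auto simp: A_def B_def incident_edges_def W_def)
  moreover have "sum x A = x {a, b} + x {a, c} + x {a, d}" "sum x B = x {a, b} + x {b, c} + x {b, d}"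
    using dist by (simp_all add: A_def B_def doubleton_eq_iff)
  \<comment> \<open>The two tightness equations add up to \<open>sum x A + sum x B = 4\<close>, with
    \<open>{a, b}\<close> counted twice, and 4 is the total degree of \<open>a\<close> and
    \<open>b\<close>.\<close>
  ultimately have "sum x (incident_edges F a - A) + sum x (incident_edges F b - B) = 0"
    using split[of a A] split[of b B] c(6) d(6) by linarith
  moreover have "0 \<le> sum x (incident_edges F u - S)" for u S
    using pos by (intro sum_nonneg) (auto intro: less_imp_le)
  ultimately have "sum x (incident_edges F a - A) = 0" "sum x (incident_edges F b - B) = 0"
    by (smt (verit))+
  moreover have "0 < sum x (incident_edges F u - S)" if "incident_edges F u - S \<noteq> {}" for u S
    using that finite_rest pos by (intro sum_pos) auto
  ultimately have R: "incident_edges F a \<subseteq> A" "incident_edges F b \<subseteq> B"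
    by (metis Diff_eq_empty_iff less_irrefl)+
  \<comment> \<open>The two triangles exhaust the degrees of \<open>a\<close> and \<open>b\<close>, hence \<open>\<plusminus>1\<close> alternating along the circuit
    \<open>a, d, b, c\<close> preserves the weight of every tight triangle.\<close>
  define y :: "'a set \<Rightarrow> real" where
    "y = (\<lambda>f. of_bool (f = {a, d}) - of_bool (f = {b, d}) + of_bool (f = {b, c}) - of_bool (f = {a, c}))"
  have y_sum: "sum y G = of_bool ({a, d} \<in> G) - of_bool ({b, d} \<in> G) + of_bool ({b, c} \<in> G)
      - of_bool ({a, c} \<in> G)" if "finite G" for G
  proof -
    have "(\<Sum>f\<in>G. of_bool (f = S) :: real) = of_bool (S \<in> G)" for S
      using that by (simp add: of_bool_def)
    then show ?thesis by (simp add: y_def sum.distrib sum_subtractf del: sum_of_bool_eq)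
  qed
  have "y {a, d} = 0"
  proof (rule inner_extreme)
    show "y f = 0" if "f \<notin> F" for f
    proof -
      have "f \<noteq> {a, d}" "f \<noteq> {b, d}" "f \<noteq> {b, c}" "f \<noteq> {a, c}" using that c(4,5) d(4,5) by blast+
      then show ?thesis by (simp add: y_def)
    qed
    show "sum y (incident_edges F v) = 0" for v
    proof -
      have fin: "finite (incident_edges F v)" using finite_F by (simp add: incident_edges_def)
      show ?thesis unfolding y_sum[OF fin] using c(4,5) d(4,5) dist by (simp add: incident_edges_def)
    qed
    show "sum y (F \<inter> Pow U) = 0" if U: "U \<in> tight_triangles" for U
    proof -
      have fin: "finite (F \<inter> Pow U)" using finite_F by simp
      have neighbour: "p \<in> {a, b, c, d}" if "{u, p} \<in> F" "u \<in> {a, b}" for u p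
        using that R by (auto simp: A_def B_def incident_edges_def doubleton_eq_iff)
      \<comment> \<open>The alternating signs make the sum factor, so it vanishes as soon as
        \<open>U\<close> treats \<open>a\<close> and \<open>b\<close> alike or \<open>c\<close> and
        \<open>d\<close> alike.\<close>
      have *: "sum y (F \<inter> Pow U) = (of_bool (a \<in> U) - of_bool (b \<in> U)) * (of_bool (d \<in> U) - of_bool (c \<in> U))"
        unfolding y_sum[OF fin] using c(4,5) d(4,5) by (simp add: algebra_simps of_bool_conj)
      show ?thesis
      proof (cases "a \<in> U \<longleftrightarrow> b \<in> U")
        case True
        then show ?thesis unfolding * by simp
      next
        case False
        \<comment> \<open>\<open>U\<close> contains exactly one of \<open>a\<close> and
          \<open>b\<close>. Its other two nodes are \<open>F\<close>-neighbours of that node, hence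
          are \<open>c\<close> and \<open>d\<close>.\<close>
        then obtain u where u: "u \<in> U" "u \<in> {a, b}" by blast
        obtain p where "p \<in> U" "u \<noteq> p" using other_node[OF U u(1)] .
        then obtain q where q: "U = {u, p, q}" "{u, p} \<in> F" "{u, q} \<in> F" "u \<noteq> p" "q \<noteq> u" "q \<noteq> p"
          using tight_triangleE[OF U u(1)] by metis
        then have "p \<in> {a, b, c, d}" "q \<in> {a, b, c, d}" using neighbour u by blast+
        moreover have "p \<notin> {a, b}" "q \<notin> {a, b}" using False q(1,4,5,6) u by blast+
        ultimately have "c \<in> U" "d \<in> U" using q(1,6) by blast+
        then show ?thesis unfolding * by simp
      qed
    qed
  qed
  then show False using dist by (simp add: y_def doubleton_eq_iff)
qed

section \<open>Counting the edges of \<open>F\<close>\<close>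

lemma finite_incident_F: "finite (incident_edges F v)"
  using finite_F by (simp add: incident_edges_def)

text \<open>A single \<open>F\<close>-edge at \<open>v\<close> would have to carry the whole degree
  2, but weights in \<open>F\<close> are below 2.\<close>

lemma two_le_card_incident_F:
  assumes "v \<in> W"
  shows "2 \<le> card (incident_edges F v)"
proof (rule ccontr)
  assume "\<not> 2 \<le> card (incident_edges F v)"
  then have "card (incident_edges F v) = 0 \<or> card (incident_edges F v) = 1" by linarith
  moreover have "incident_edges F v \<noteq> {}" using assms by (auto simp: W_def incident_edges_def)
  ultimately have "card (incident_edges F v) = 1" using finite_incident_F by auto
  then obtain f where f: "incident_edges F v = {f}" by (auto simp: card_1_singleton_iff)
  then have "x f = 2" "f \<in> F" using degree_F[OF assms] by (auto simp: incident_edges_def)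
  then show False using F_less by force
qed

lemma card_incident_tight_triangle:
  assumes "T \<in> tight_triangles" "v \<in> T"
  shows "card (incident_edges (F \<inter> Pow T) v) = 2"
proof -
  obtain b where b: "b \<in> T" "v \<noteq> b" using other_node[OF assms] .
  obtain c where c: "c \<noteq> v" "c \<noteq> b" "F \<inter> Pow T = {{v, b}, {v, c}, {b, c}}"
    using tight_triangleE[OF assms b] .
  have "incident_edges (F \<inter> Pow T) v = {{v, b}, {v, c}}"
    unfolding incident_edges_def c(3) using b c(1,2) by auto
  then show ?thesis using c(1,2) by (simp add: doubleton_eq_iff)
qed

text \<open>With \<open>k\<close> tight triangles at \<open>v\<close>, edge-disjointness gives
  \<open>2 * k\<close> edges, which suffices for \<open>k \<ge> 2\<close>. For \<open>k = 1\<close>,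
  if the two triangle edges at \<open>v\<close> were the only ones, they would carry weight 2 and
  leave nothing for the third edge of the tight triangle.\<close>

lemma card_incident_F_ge:
  assumes v: "v \<in> W"
  shows "2 + card {T \<in> tight_triangles. v \<in> T} \<le> card (incident_edges F v)"
proof -
  define K where "K = {T \<in> tight_triangles. v \<in> T}"
  have finK: "finite K" using finite_tight_triangles by (simp add: K_def)
  have "card (\<Union>T\<in>K. incident_edges (F \<inter> Pow T) v) = (\<Sum>T\<in>K. card (incident_edges (F \<inter> Pow T) v))"
  proof (intro card_UN_disjoint ballI impI)
    show "finite (incident_edges (F \<inter> Pow T) v)" for T
      using finite_F by (simp add: incident_edges_def)
    show "incident_edges (F \<inter> Pow T) v \<inter> incident_edges (F \<inter> Pow T') v = {}"
      if "T \<in> K" "T' \<in> K" "T \<noteq> T'" for T T'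
      using tight_triangles_edge_disjoint[of T T'] that by (auto simp: K_def incident_edges_def)
  qed (rule finK)
  also have "\<dots> = (\<Sum>T\<in>K. 2)"
    by (intro sum.cong) (auto simp: K_def card_incident_tight_triangle)
  finally have "card (\<Union>T\<in>K. incident_edges (F \<inter> Pow T) v) = 2 * card K" by simp
  moreover have "(\<Union>T\<in>K. incident_edges (F \<inter> Pow T) v) \<subseteq> incident_edges F v"
    by (auto simp: incident_edges_def)
  ultimately have two: "2 * card K \<le> card (incident_edges F v)"
    using card_mono[OF finite_incident_F] by metis
  have three: "3 \<le> card (incident_edges F v)" if one: "card K = 1"
  proof (rule ccontr)
    assume "\<not> 3 \<le> card (incident_edges F v)"
    then have card2: "card (incident_edges F v) = 2" using two_le_card_incident_F[OF v] by linarith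
    obtain T where "K = {T}" using one by (rule card_1_singletonE)
    then have T: "T \<in> tight_triangles" "v \<in> T" by (auto simp: K_def)
    obtain b where b: "b \<in> T" "v \<noteq> b" using other_node[OF T] .
    obtain c where c: "c \<noteq> v" "c \<noteq> b" "{v, b} \<in> F" "{v, c} \<in> F" "{b, c} \<in> F"
        "x {v, b} + x {v, c} + x {b, c} = 2"
      using tight_triangleE[OF T b] .
    have "{{v, b}, {v, c}} = incident_edges F v"
      using c card2 by (intro card_subset_eq[OF finite_incident_F])
        (auto simp: incident_edges_def doubleton_eq_iff)
    then have "sum x {{v, b}, {v, c}} = 2" using degree_F[OF v] by simp
    moreover have "sum x {{v, b}, {v, c}} = x {v, b} + x {v, c}"
      using c(1,2) by (simp add: doubleton_eq_iff)
    ultimately have "x {v, b} + x {v, c} = 2" by linarith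
    then show False using c(5,6) F_pos by fastforce
  qed
  show ?thesis
  proof (cases "card K = 0 \<or> card K = 1")
    case True
    then show ?thesis using three two_le_card_incident_F[OF v] unfolding K_def[symmetric] by auto
  next
    case False
    then show ?thesis using two unfolding K_def[symmetric] by linarith
  qed
qed

text \<open>The conditions in \<open>inner_extreme\<close> form a homogeneous system with one
  equation per node of \<open>W\<close> and one per tight triangle. With more unknowns than
  equations it would have a nonzero solution.\<close>

lemma card_F_le: "card F \<le> card W + card tight_triangles"
proof (rule ccontr)
  define A where "A = (\<lambda>v e. of_bool (v \<in> e) :: real) ` W \<union> (\<lambda>T e. of_bool (e \<subseteq> T)) ` tight_triangles"
  assume "\<not> card F \<le> card W + card tight_triangles"
  moreover have "card A \<le> card W + card tight_triangles"
    unfolding A_def using finite_W finite_tight_triangles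
    by (intro order_trans[OF card_Un_le] add_mono card_image_le)
  ultimately have "card A < card F" by linarith
  moreover have "finite A" using finite_W finite_tight_triangles by (simp add: A_def)
  ultimately obtain y where y: "\<exists>e\<in>F. y e \<noteq> 0" "\<And>e. e \<notin> F \<Longrightarrow> y e = 0"
      and A: "\<And>a. a \<in> A \<Longrightarrow> (\<Sum>e\<in>F. a e * y e) = 0"
    using homogeneous_system_nontrivial[OF _ finite_F, of A] by blast
  have "y e = 0" for e
  proof (rule inner_extreme[OF y(2)])
    have *: "(\<Sum>e\<in>F. of_bool (P e) * y e) = sum y {e \<in> F. P e}" for P
      using finite_F by (simp add: sum.inter_filter of_bool_def if_distrib[of "\<lambda>z. z * _"] cong: if_cong)
    show "sum y (incident_edges F v) = 0" if "v \<in> W" for v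
      using A[of "\<lambda>e. of_bool (v \<in> e)"] that unfolding * incident_edges_def by (simp add: A_def)
    show "sum y (F \<inter> Pow T) = 0" if "T \<in> tight_triangles" for T
    proof -
      have "F \<inter> Pow T = {e \<in> F. e \<subseteq> T}" by blast
      then show ?thesis using A[of "\<lambda>e. of_bool (e \<subseteq> T)"] that unfolding * by (simp add: A_def)
    qed
  qed
  then show False using y(1) by blast
qed

lemma tight_triangle_subset_W:
  assumes "T \<in> tight_triangles"
  shows "T \<subseteq> W"
proof
  fix a assume a: "a \<in> T"
  obtain b where b: "b \<in> T" "a \<noteq> b" using other_node[OF assms a] .
  then show "a \<in> W" using tight_triangleE[OF assms a b] unfolding W_def by blast
qed

lemma sum_degrees_F: "(\<Sum>v\<in>W. card (incident_edges F v)) = 2 * card F"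
proof -
  have "{v \<in> W. v \<in> e} = e" if "e \<in> F" for e using that by (auto simp: W_def)
  then show ?thesis unfolding incident_edges_def
    using sum_multicount[OF finite_W finite_F, of "\<lambda>v e. v \<in> e" 2] card_F_edge by simp
qed

lemma sum_tight_triangles_at: "(\<Sum>v\<in>W. card {T \<in> tight_triangles. v \<in> T}) = 3 * card tight_triangles"
proof -
  have "{v \<in> W. v \<in> T} = T" if "T \<in> tight_triangles" for T
    using that tight_triangle_subset_W by blast
  then show ?thesis
    using sum_multicount[OF finite_W finite_tight_triangles, of "\<lambda>v T. v \<in> T" 3]
    by (simp add: tight_triangles_def)
qed

text \<open>With \<open>t\<close> tight triangles, summing the degree bounds gives
  \<open>2 * card W + 3 * t \<le> 2 * card F\<close>, while \<open>card_F_le\<close> bounds the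
  right side by \<open>2 * card W + 2 * t\<close>. So \<open>t = 0\<close>, and every degree bound
  holds with equality.\<close>

lemma no_tight_triangles: "tight_triangles = {}"
  and F_two_regular: "v \<in> W \<Longrightarrow> card (incident_edges F v) = 2"
proof -
  have "(\<Sum>v\<in>W. 2 + card {T \<in> tight_triangles. v \<in> T}) \<le> (\<Sum>v\<in>W. card (incident_edges F v))"
    by (intro sum_mono card_incident_F_ge)
  then have *: "2 * card W + 3 * card tight_triangles \<le> 2 * card F"
    unfolding sum.distrib sum_tight_triangles_at sum_degrees_F by simp
  then have "card tight_triangles = 0" using card_F_le by linarith
  then show none: "tight_triangles = {}" using finite_tight_triangles by simp
  then have "card F = card W" using * card_F_le by simp
  then have "(\<Sum>v\<in>W. 2) = (\<Sum>v\<in>W. card (incident_edges F v))" by (simp add: sum_degrees_F)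
  then show "v \<in> W \<Longrightarrow> card (incident_edges F v) = 2"
    using sum_mono_inv[of "\<lambda>_. 2" W "\<lambda>v. card (incident_edges F v)" v]
      two_le_card_incident_F finite_W by simp
qed

section \<open>Integrality and odd circuits\<close>

text \<open>At each node of \<open>W\<close> two edges of \<open>F\<close> have total weight 2, so
  subtracting 1 on \<open>F\<close> leaves degree sums 0. With no tight triangles left,
  \<open>inner_extreme\<close> forces this difference to vanish.\<close>

lemma inner_value:
  assumes "e \<in> F"
  shows "x e = 1"
proof -
  define y where "y e = (if e \<in> F then x e - 1 else 0)" for e
  have "y e = 0"
  proof (rule inner_extreme)
    show "sum y (incident_edges F v) = 0" if "v \<in> W" for v
    proof -
      have "sum y (incident_edges F v) = (\<Sum>e\<in>incident_edges F v. x e - 1)"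
        by (intro sum.cong) (auto simp: y_def incident_edges_def)
      then show ?thesis using degree_F[OF that] F_two_regular[OF that] by (simp add: sum_subtractf)
    qed
  qed (auto simp: y_def no_tight_triangles)
  then show ?thesis using assms by (simp add: y_def)
qed

lemma value_cases: "e \<in> E \<Longrightarrow> x e = 0 \<or> x e = 1 \<or> x e = 2"
  using inner_value[of e] le_2[of e] nonneg[of e] by (force simp: F_def)

lemma F_eq: "F = {e \<in> E. x e = 1}"
  using inner_value by (auto simp: F_def)

text \<open>Signs alternating along an even circuit cancel at every node and would form a nonzero
  perturbation.\<close>

lemma no_even_circuit:
  assumes "circuit n C" "C \<subseteq> F"
  shows "odd n"
proof
  assume even: "even n"
  obtain vs where vs: "distinct vs" "length vs = n" and n: "3 \<le> n"
    and C: "C = {{vs ! i, vs ! (Suc i mod n)} | i. i < n}"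
    using assms(1) unfolding circuit_def by blast
  define f where "f i = {vs ! i, vs ! (Suc i mod n)}" for i
  \<comment> \<open>Summing over positions allows an exchange of summation at each node; for
    \<open>y (f 0) = 1\<close> it then suffices that no other position gives the edge
    \<open>f 0\<close>.\<close>
  define y :: "'a set \<Rightarrow> real" where "y e = (\<Sum>i<n. if e = f i then (-1) ^ i else 0)" for e
  have f: "f i \<in> F" if "i < n" for i using assms(2) that unfolding C f_def by blast
  have "y (f 0) = 0"
  proof (rule inner_extreme)
    show "y e = 0" if "e \<notin> F" for e
      unfolding y_def using that f by (intro sum.neutral) auto
    show "sum y (incident_edges F v) = 0" for v
    proof -
      have "sum y (incident_edges F v) = (\<Sum>i<n. \<Sum>e\<in>incident_edges F v. if e = f i then (-1) ^ i else 0)"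
        unfolding y_def by (rule sum.swap)
      also have "\<dots> = (\<Sum>i<n. if v \<in> f i then (-1) ^ i else 0)"
        using finite_incident_F f by (intro sum.cong) (auto simp: incident_edges_def)
      also have "\<dots> = (\<Sum>i | i < n \<and> v \<in> f i. (-1) ^ i)"
        by (subst sum.inter_filter[symmetric]) simp_all
      also have "\<dots> = 0"
      proof (cases "v \<in> set vs")
        case False
        moreover have "f i \<subseteq> set vs" if "i < n" for i
          using that vs n by (simp add: f_def)
        ultimately have none: "{i. i < n \<and> v \<in> f i} = {}" by blast
        show ?thesis unfolding none by simp
      next
        case True
        then obtain j where j: "j < n" "v = vs ! j" using vs by (auto simp: in_set_conv_nth)
        have at: "v \<in> f i \<longleftrightarrow> i = j \<or> Suc i mod n = j" if "i < n" for i
        proof -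
          have "Suc i mod n < n" using n by simp
          then show ?thesis
            using nth_eq_iff_index_eq[OF vs(1), of j] that j vs(2) by (auto simp: f_def)
        qed
        show ?thesis
        proof (cases j)
          case 0
          \<comment> \<open>At the node where the circuit closes, the signs at positions 0 and
            \<open>n - 1\<close> cancel because \<open>n\<close> is even.\<close>
          have two: "{i. i < n \<and> v \<in> f i} = {0, n - 1}"
          proof (intro set_eqI iffI)
            fix i assume "i \<in> {i. i < n \<and> v \<in> f i}"
            then have "i < n" "i = 0 \<or> Suc i mod n = 0"
              using at 0 by auto
            then show "i \<in> {0, n - 1}" by (auto simp: mod_Suc split: if_splits)
          qed (use at n j 0 in auto)
          have "odd (n - 1)" "n - 1 \<noteq> 0" using n even by auto
          then show ?thesis unfolding two by simp
        next
          case (Suc k)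
          have two: "{i. i < n \<and> v \<in> f i} = {Suc k, k}"
          proof (intro set_eqI iffI)
            fix i assume "i \<in> {i. i < n \<and> v \<in> f i}"
            then have "i < n" "i = Suc k \<or> Suc i mod n = Suc k"
              using at Suc by auto
            then show "i \<in> {Suc k, k}" by (auto simp: mod_Suc split: if_splits)
          qed (use at n j Suc in auto)
          show ?thesis unfolding two by simp
        qed
      qed
      finally show ?thesis .
    qed
  qed (simp add: no_tight_triangles)
  moreover have "f i \<noteq> f 0" if "i < n" "i \<noteq> 0" for i
  proof -
    \<comment> \<open>Position \<open>i\<close> could repeat the edge \<open>f 0\<close> with its
      ends reversed only for \<open>i = 1\<close> followed by position 0, that is, for
      \<open>n = 2\<close>.\<close>
    have "Suc i mod n \<noteq> i" "i \<noteq> 1 \<or> Suc i mod n \<noteq> 0" using that n by (auto simp: mod_Suc)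
    moreover have "Suc i mod n < n" "0 < n" "1 < n" using n by simp_all
    ultimately show ?thesis
      using that n vs(2) nth_eq_iff_index_eq[OF vs(1)] by (auto simp: f_def doubleton_eq_iff)
  qed
  then have "y (f 0) = (\<Sum>i<n. if i = 0 then 1 else 0)"
    unfolding y_def by (intro sum.cong) auto
  then have "y (f 0) = 1" using n by simp
  ultimately show False by simp
qed

end

section \<open>Circuit decomposition of 2-regular edge sets\<close>

text \<open>A longest path can only be continued back to its first node.\<close>

lemma two_regular_circuit_exists:
  assumes finite: "finite F" and ne: "F \<noteq> {}" and edge: "\<And>e. e \<in> F \<Longrightarrow> card e = 2"
    and deg: "\<And>v. v \<in> \<Union>F \<Longrightarrow> card (incident_edges F v) = 2"
  obtains n C where "circuit n C" "C \<subseteq> F" "\<And>e. e \<in> F \<Longrightarrow> e \<inter> \<Union>C \<noteq> {} \<Longrightarrow> e \<in> C"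
proof -
  have finV: "finite (\<Union>F)" 
  proof (rule finite_Union[OF finite])
    show "finite e" if "e \<in> F" for e using edge[OF that] by (metis card.infinite zero_neq_numeral)
  qed
  define path where "path vs \<longleftrightarrow> distinct vs \<and> set vs \<subseteq> \<Union>F \<and>
      (\<forall>i. Suc i < length vs \<longrightarrow> {vs ! i, vs ! Suc i} \<in> F)" for vs
  \<comment> \<open>Two distinct edges at \<open>p\<close> are all the edges at \<open>p\<close>;
    this is how 2-regularity is used below.\<close>
  have inc: "e \<in> {{p, q}, {p, r}}" if "{p, q} \<in> F" "{p, r} \<in> F" "q \<noteq> r" "e \<in> F" "p \<in> e" for e p q r
  proof -
    have fin: "finite (incident_edges F p)" using finite by (simp add: incident_edges_def)
    have "p \<in> \<Union>F" using that by blast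
    then have "card (incident_edges F p) = 2" by (rule deg)
    moreover have "card {{p, q}, {p, r}} = 2" using that(3) by (simp add: doubleton_eq_iff)
    moreover have "{{p, q}, {p, r}} \<subseteq> incident_edges F p" using that by (simp add: incident_edges_def)
    ultimately have "{{p, q}, {p, r}} = incident_edges F p" by (metis card_subset_eq fin)
    moreover have "e \<in> incident_edges F p" using that by (simp add: incident_edges_def)
    ultimately show ?thesis by simp
  qed
  have noloop: "p \<noteq> q" if "{p, q} \<in> F" for p q using edge[OF that] by auto
  have other: "\<exists>r. {p, r} \<in> F \<and> r \<noteq> q" if "{p, q} \<in> F" for p q
  proof (rule ccontr)
    assume none: "\<not> ?thesis"
    have "incident_edges F p \<subseteq> {{p, q}}"
    proof
      fix e assume e: "e \<in> incident_edges F p"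
      then have "card e = 2" using edge by (auto simp: incident_edges_def)
      then obtain a b where "e = {a, b}" by (auto simp: card_2_iff)
      then obtain r where "e = {p, r}" using e by (auto simp: incident_edges_def)
      then show "e \<in> {{p, q}}" using e none by (auto simp: incident_edges_def)
    qed
    then have "card (incident_edges F p) \<le> 1" using card_mono[of "{{p, q}}"] by fastforce
    then show False using deg[of p] that by auto
  qed
  obtain e where "e \<in> F" using ne by blast
  then obtain a b where ab: "{a, b} \<in> F" "a \<noteq> b" using edge by (metis card_2_iff)
  have path_ab: "path [a, b]" using ab by (auto simp: path_def)
  have bound: "length vs < Suc (card (\<Union>F))" if "path vs" for vs
    using that card_mono[OF finV, of "set vs"] by (auto simp: path_def distinct_card)
  obtain vs where vs: "path vs" and max: "\<And>ws. path ws \<Longrightarrow> length ws \<le> length vs"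
    using ex_has_greatest_nat[of path, OF path_ab, of length "Suc (card (\<Union>F))"] bound
    by (metis less_imp_le)
  define n where "n = length vs"
  have n2: "2 \<le> n" using max[OF path_ab] by (simp add: n_def)
  have dist: "distinct vs" and step: "\<And>i. Suc i < n \<Longrightarrow> {vs ! i, vs ! Suc i} \<in> F"
    using vs by (auto simp: path_def n_def)
  have neq: "vs ! i \<noteq> vs ! j" if "i < n" "j < n" "i \<noteq> j" for i j
    using that dist by (simp add: nth_eq_iff_index_eq n_def)
  have "{vs ! 0, vs ! 1} \<in> F" using step[of 0] n2 by simp
  \<comment> \<open>The second neighbour of the first node. Were it off the path, it could be put in
    front, against maximality.\<close>
  then obtain w where w: "{vs ! 0, w} \<in> F" "w \<noteq> vs ! 1" using other by blast
  have "w \<in> set vs"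
  proof (rule ccontr)
    assume "w \<notin> set vs"
    then have "path (w # vs)"
      using vs w n2 by (auto simp: path_def nth_Cons insert_commute n_def split: nat.splits)
    then show False using max by fastforce
  qed
  then obtain k where k: "k < n" "w = vs ! k" by (auto simp: in_set_conv_nth n_def)
  have "k \<noteq> 0" using noloop[OF w(1)] k(2) by metis
  moreover have "k \<noteq> 1" using w(2) k(2) by metis
  ultimately have k2: "2 \<le> k" by linarith
  \<comment> \<open>An inner node \<open>vs ! k\<close> already has its two path edges, so the edge
    to \<open>vs ! 0\<close> would be a third one.\<close>
  have "k = n - 1"
  proof (rule ccontr)
    assume "k \<noteq> n - 1"
    then have "{vs ! k, vs ! Suc k} \<in> F" using step k by simp
    moreover have "{vs ! k, vs ! (k - 1)} \<in> F" using step[of "k - 1"] k k2 by (simp add: insert_commute)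
    moreover have "vs ! Suc k \<noteq> vs ! (k - 1)" using neq k k2 \<open>k \<noteq> n - 1\<close> by simp
    ultimately have "{vs ! 0, vs ! k} \<in> {{vs ! k, vs ! Suc k}, {vs ! k, vs ! (k - 1)}}"
      using inc[of "vs ! k" "vs ! Suc k" "vs ! (k - 1)" "{vs ! 0, vs ! k}"] w k by simp
    moreover have "vs ! 0 \<noteq> vs ! Suc k" "vs ! 0 \<noteq> vs ! (k - 1)" "vs ! 0 \<noteq> vs ! k"
      by (rule neq; use k k2 \<open>k \<noteq> n - 1\<close> in linarith)+
    ultimately show False by (auto simp: doubleton_eq_iff)
  qed
  then have n3: "3 \<le> n" and close: "{vs ! (n - 1), vs ! 0} \<in> F"
    using k2 k w by (auto simp: insert_commute)
  define C where "C = {{vs ! i, vs ! (Suc i mod n)} | i. i < n}"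
  have next_edge: "{vs ! i, vs ! (Suc i mod n)} \<in> F" if "i < n" for i
  proof (cases "Suc i = n")
    case True
    then have "i = n - 1" by simp
    then show ?thesis using close True by simp
  qed (use that step in auto)
  have "circuit n C" unfolding circuit_def C_def using dist n3 n_def by blast
  moreover have "C \<subseteq> F" unfolding C_def using next_edge by blast
  moreover have "e \<in> C" if e: "e \<in> F" and meets: "e \<inter> \<Union>C \<noteq> {}" for e
  proof -
    obtain v where v: "v \<in> e" "v \<in> \<Union>C" using meets by blast
    then obtain i where "i < n" "v \<in> {vs ! i, vs ! (Suc i mod n)}" unfolding C_def by blast
    moreover have "Suc i mod n < n" using n3 by simp
    ultimately obtain j where j: "j < n" "v = vs ! j" by blast
    \<comment> \<open>The cyclic predecessor of \<open>j\<close>. Since \<open>n \<ge> 3\<close>,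
      the two neighbours of \<open>v\<close> on \<open>C\<close> differ, so the edges of
      \<open>C\<close> at \<open>v\<close> are all the edges of \<open>F\<close> there.\<close>
    define i where "i = (if j = 0 then n - 1 else j - 1)"
    have i: "i < n" "Suc i mod n = j" using j n3 by (auto simp: i_def)
    have "vs ! (Suc j mod n) \<noteq> vs ! i"
      using n3 j i by (intro neq) (auto simp: i_def mod_Suc split: if_splits)
    moreover have "{v, vs ! i} \<in> F" using next_edge[OF i(1)] i j by (simp add: insert_commute)
    ultimately have "e \<in> {{v, vs ! (Suc j mod n)}, {v, vs ! i}}"
      using inc[of v "vs ! (Suc j mod n)" "vs ! i" e] e v next_edge[OF j(1)] j(2) by blast
    moreover have "{v, vs ! i} = {vs ! i, vs ! (Suc i mod n)}" using i j by (simp add: insert_commute)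
    ultimately show ?thesis unfolding C_def using i j by auto
  qed
  ultimately show thesis by (rule that)
qed

text \<open>Circuits are split off one at a time. Every edge of \<open>F\<close> that meets the
  circuit \<open>C\<close> belongs to it, so removing \<open>C\<close> keeps the degrees at the
  remaining nodes, and later circuits avoid the nodes of \<open>C\<close>.\<close>

lemma two_regular_circuit_decomposition:
  assumes "finite F" and "\<And>e. e \<in> F \<Longrightarrow> card e = 2"
    and "\<And>v. v \<in> \<Union>F \<Longrightarrow> card (incident_edges F v) = 2"
  shows "\<exists>P. partition_on F P \<and> (\<forall>C\<in>P. \<exists>n. circuit n C) \<and> pairwise (\<lambda>C D. disjnt (\<Union>C) (\<Union>D)) P"
  using assms
proof (induction "card F" arbitrary: F rule: less_induct)
  case less
  show ?case
  proof (cases "F = {}")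
    case True
    then show ?thesis by (intro exI[of _ "{}"]) (auto simp: partition_on_def)
  next
    case False
    obtain n C where C: "circuit n C" "C \<subseteq> F"
      and closed: "\<And>e. e \<in> F \<Longrightarrow> e \<inter> \<Union>C \<noteq> {} \<Longrightarrow> e \<in> C"
      using two_regular_circuit_exists[OF less.prems(1) False less.prems(2,3)] by blast
    have "{f i |i. i < n} \<noteq> {}" if "0 < n" for f :: "nat \<Rightarrow> 'a set" using that by blast
    then have Cne: "C \<noteq> {}" using C(1) by (auto simp: circuit_def)
    have "card (F - C) < card F" using Cne C less.prems(1) by (intro psubset_card_mono) auto
    moreover have "card (incident_edges (F - C) v) = 2" if "v \<in> \<Union>(F - C)" for v
    proof -
      have "incident_edges (F - C) v = incident_edges F v"
        using that closed by (auto simp: incident_edges_def)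
      then show ?thesis using that less.prems(3) by auto
    qed
    ultimately obtain P where P: "partition_on (F - C) P" "\<forall>C\<in>P. \<exists>n. circuit n C"
        "pairwise (\<lambda>C D. disjnt (\<Union>C) (\<Union>D)) P"
      using less.hyps[of "F - C"] less.prems(1,2) by auto
    have "partition_on F (insert C P)"
      using P(1) Cne C(2) by (subst partition_on_insert) (auto simp: partition_on_def disjnt_def)
    moreover have "disjnt (\<Union>C) (\<Union>D)" if "D \<in> P" for D
    proof -
      have "D \<subseteq> F - C" using P(1) that by (auto simp: partition_on_def)
      then show ?thesis using closed by (fastforce simp: disjnt_def)
    qed
    then have "pairwise (\<lambda>C D. disjnt (\<Union>C) (\<Union>D)) (insert C P)"
      using P(3) by (auto simp: pairwise_insert disjnt_sym)
    ultimately show ?thesis using P(2) C(1) by (intro exI[of _ "insert C P"]) auto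
  qed
qed

section \<open>From the extreme point to the 2-matching\<close>

theorem corollary2:
  fixes V :: "'a set" and E :: "'a set set" and d :: nat
  assumes "d \<ge> 3"
    and "regular_graph d V E"
  shows "\<exists>x. two_matching V E x \<and> basic_matching E x \<and> perfect_matching V E x \<and>
             triangle_free_matching E x"
proof -
  have "simple_graph V E" using assms(2) by (simp add: regular_graph_def)
  then obtain x where "extreme_point V E x"
    using extreme_point_exists uniform_in_triangle_polytope[OF assms] by blast
  then interpret extreme_point V E x .
  \<comment> \<open>On \<open>E\<close> the values of \<open>x\<close> are already 0, 1 or 2, so
    rounding down only changes the type.\<close>
  define z where "z e = nat \<lfloor>x e\<rfloor>" for e
  have real_z: "real (z e) = x e" if "e \<in> E" for e
    using value_cases[OF that] by (auto simp: z_def)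
  have z_range: "z e \<in> {0, 1, 2}" if "e \<in> E" for e
    using value_cases[OF that] by (auto simp: z_def)
  have z_degree: "sum z (incident_edges E v) = 2" if "v \<in> V" for v
  proof -
    have "real (sum z (incident_edges E v)) = sum x (incident_edges E v)"
      unfolding of_nat_sum by (intro sum.cong) (auto simp: real_z incident_edges_def)
    then have "real (sum z (incident_edges E v)) = real 2" using degree[OF that] by simp
    then show ?thesis by (simp only: of_nat_eq_iff)
  qed
  have "two_matching V E z" using z_range z_degree by (simp add: two_matching_def)
  moreover have "perfect_matching V E z"
  proof -
    \<comment> \<open>The weights are double counted over incident pairs of nodes and edges: each
      node receives 2, and each edge is counted at both ends.\<close>
    have "2 * card V = (\<Sum>v\<in>V. \<Sum>e | e \<in> E \<and> v \<in> e. z e)"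
      using z_degree by (simp add: incident_edges_def)
    also have "\<dots> = (\<Sum>e\<in>E. \<Sum>v | v \<in> V \<and> v \<in> e. z e)"
      using finite_nodes finite_edges by (rule sum.swap_restrict)
    also have "\<dots> = (\<Sum>e\<in>E. 2 * z e)"
    proof (rule sum.cong)
      fix e assume e: "e \<in> E"
      then have "{v. v \<in> V \<and> v \<in> e} = e" using edge_subset by blast
      then show "(\<Sum>v | v \<in> V \<and> v \<in> e. z e) = 2 * z e" using card_edge[OF e] by simp
    qed simp
    finally show ?thesis
      by (simp add: perfect_matching_def matching_size_def flip: sum_distrib_left)
  qed
  moreover have "basic_matching E z"
  proof -
    have eq: "{e \<in> E. z e = 1} = F" using real_z unfolding F_eq by force
    obtain P where P: "partition_on F P" "\<forall>C\<in>P. \<exists>n. circuit n C"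
        "pairwise (\<lambda>C D. disjnt (\<Union>C) (\<Union>D)) P"
      using two_regular_circuit_decomposition[OF finite_F card_F_edge F_two_regular] W_def by blast
    have "C \<subseteq> F" if "C \<in> P" for C using P(1) that by (auto simp: partition_on_def)
    then have "\<forall>C\<in>P. \<exists>n. odd n \<and> circuit n C" using P(2) no_even_circuit by blast
    then show ?thesis unfolding basic_matching_def eq using P(1,3) by blast
  qed
  moreover have "triangle_free_matching E z"
    unfolding triangle_free_matching_def circuit_3_iff
  proof
    assume "\<exists>C\<subseteq>matching_support E z. \<exists>a b c. a \<noteq> b \<and> b \<noteq> c \<and> a \<noteq> c \<and> C = {{a, b}, {b, c}, {c, a}}"
    then obtain a b c where dist: "a \<noteq> b" "b \<noteq> c" "a \<noteq> c"
      and sub: "{{a, b}, {b, c}, {c, a}} \<subseteq> matching_support E z" by blast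
    have supp: "e \<in> E" "1 \<le> z e" if "e \<in> {{a, b}, {b, c}, {c, a}}" for e
      using sub that by (auto simp: matching_support_def)
    have "1 \<le> x e" if "e \<in> {{a, b}, {b, c}, {c, a}}" for e
      using supp[OF that] real_z[of e] by simp
    \<comment> \<open>Integrality makes each support edge weigh at least 1, so a triangle in the
      support would weigh at least 3, against its bound 2 in the polytope.\<close>
    then have "(\<Sum>e\<in>{{a, b}, {b, c}, {c, a}}. 1) \<le> sum x {{a, b}, {b, c}, {c, a}}"
      by (rule sum_mono)
    also have "\<dots> \<le> sum x (E \<inter> Pow {a, b, c})"
      using supp(1) finite_edges nonneg by (intro sum_mono2) auto
    also have "\<dots> \<le> 2"
      using supp(1) edge_subset dist by (intro triangle_le) auto
    finally show False using dist by (simp add: doubleton_eq_iff)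
  qed
  ultimately show ?thesis by blast
qed

end
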